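(* Let $\eta$ be a finite Borel measure on $[0,1)$. Then the Berezin transform of $\nu_\eta$ is given by $$\operatorname{Ber}_{\nu_\eta}(w)=\beta_\eta(|w|)\qquad(w\in\mathbb{D}),$$ where $\beta_\eta(a)=2(1-a^2)^2\int_{[0,1)}\frac{1+a^2r^2}{(1-a^2r^2)^3}\,\mathrm{d}\eta(r)$ for $a\in[0,1)$.
   Context: $\mathbb{D}$ is the open unit disk and $\mathbb{T}$ the unit circle; measures are positive. $\nu_\eta$ is the pushforward of $\eta\times\lambda_{\mathbb{T}}$ under $[0,1)\times\mathbb{T}\to\mathbb{D}$, $(r,\tau)\mapsto r\tau$, where $\lambda_{\mathbb{T}}$ is the Haar measure on $\mathbb{T}$ with $\lambda_{\mathbb{T}}(\mathbb{T})=2\pi$. For a finite Borel measure $\mu$ on $\mathbb{D}$, its Berezin transform is $\operatorname{Ber}_\mu(z)=\frac1\pi(1-|z|^2)^2\int_{\mathbb{D}}\frac{\mathrm{d}\mu(w)}{|1-\overline{z}w|^4}$, $z\in\mathbb{D}$. *)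

theory Defs
  imports "HOL-Analysis.Analysis"
begin

abbreviation disk_borel :: "complex measure" where
  "disk_borel \<equiv> restrict_space borel (ball 0 1)"

abbreviation circle_borel :: "complex measure" where
  "circle_borel \<equiv> restrict_space borel (sphere 0 1)"

abbreviation unit_interval_borel :: "real measure" where
  "unit_interval_borel \<equiv> restrict_space borel {0..<1}"

text \<open>Finite Borel measures on the compact metric space \<open>sphere 0 1\<close> are automatically regular,
  so the following conditions single out the Haar measure of the circle group normalised to have
  total mass \<open>2 * pi\<close>.\<close>

definition circle_haar :: "complex measure \<Rightarrow> bool" where
  "circle_haar lam \<longleftrightarrow>
     sets lam = sets circle_borel \<and>
     (\<forall>u \<in> sphere 0 1. distr lam circle_borel (\<lambda>t. u * t) = lam) \<and>
     emeasure lam (space lam) = ennreal (2 * pi)"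

definition nu :: "complex measure \<Rightarrow> real measure \<Rightarrow> complex measure" where
  "nu lam eta = distr (eta \<Otimes>\<^sub>M lam) disk_borel (\<lambda>(r, t). complex_of_real r * t)"

text \<open>The arguments below are measures on the disk, so that the integral is over the disk.\<close>

definition Ber :: "complex measure \<Rightarrow> complex \<Rightarrow> real" where
  "Ber mu z = 1 / pi * (1 - (cmod z)\<^sup>2)\<^sup>2 * (\<integral>w. 1 / cmod (1 - cnj z * w) ^ 4 \<partial>mu)"

definition beta :: "real measure \<Rightarrow> real \<Rightarrow> real" where
  "beta eta a = 2 * (1 - a\<^sup>2)\<^sup>2 * (\<integral>r. (1 + a\<^sup>2 * r\<^sup>2) / (1 - a\<^sup>2 * r\<^sup>2) ^ 3 \<partial>eta)"

lemma measurable_rotation: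
  assumes "cmod u = 1"
  shows "(\<lambda>t. u * t) \<in> circle_borel \<rightarrow>\<^sub>M circle_borel"
  using assms
  by (intro measurable_restrict_space3) (auto simp: norm_mult)

lemma nn_integral_shift:
  fixes g :: "real \<Rightarrow> ennreal"
  assumes "g \<in> borel_measurable borel"
  shows "(\<integral>\<^sup>+t. g (c + t) \<partial>lborel) = (\<integral>\<^sup>+t. g t \<partial>lborel)"
  using nn_integral_real_affine[OF assms, of 1 c] by simp

text \<open>Such a measure exists: arc length.\<close>

lemma circle_haar_arc_length:
  "circle_haar (distr (restrict_space lborel {0..<2*pi}) circle_borel cis)"
proof -
  define P where "P = restrict_space lborel {0..<2*pi}"
  define arc where "arc = distr P circle_borel cis"
  have cisb [measurable]: "cis \<in> borel_measurable borel"
    by (intro borel_measurable_continuous_onI continuous_intros)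
  have cism: "cis \<in> P \<rightarrow>\<^sub>M circle_borel"
    unfolding P_def by (intro measurable_restrict_space3) auto
  have "distr arc circle_borel (\<lambda>t. u * t) = arc" if u: "cmod u = 1" for u
  proof (rule measure_eqI)
    show "sets (distr arc circle_borel (\<lambda>t. u * t)) = sets arc" by (simp add: arc_def)
    fix A assume "A \<in> sets (distr arc circle_borel (\<lambda>t. u * t))"
    then have Ac: "A \<in> sets circle_borel" by simp
    then have [measurable]: "A \<in> sets borel"
      by (auto simp: sets_restrict_space)
    from u obtain s where s: "0 \<le> s" "s < 2*pi" "u = cis s"
      using Arg2pi_ge_0 Arg2pi_lt_2pi Arg2pi_eq[of u]
      by (metis cis_conv_exp mult_1 of_real_1)
    define g :: "real \<Rightarrow> ennreal" where "g = (\<lambda>t. indicator A (cis t))"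
    have [measurable]: "g \<in> borel_measurable borel" unfolding g_def by measurable
    have mu: "(\<lambda>t. u * t) \<in> arc \<rightarrow>\<^sub>M circle_borel"
      using measurable_rotation[OF u] by (simp add: arc_def)
    have "emeasure (distr arc circle_borel (\<lambda>t. u * t)) A
        = (\<integral>\<^sup>+x. indicator A x \<partial>distr arc circle_borel (\<lambda>t. u * t))"
      using Ac by simp
    also have "\<dots> = (\<integral>\<^sup>+x. indicator A (u * x) \<partial>arc)"
      using Ac by (subst nn_integral_distr[OF mu]) auto
    also have "\<dots> = (\<integral>\<^sup>+t. indicator A (u * cis t) \<partial>P)"
      unfolding arc_def
      using measurable_compose[OF measurable_rotation[OF u] borel_measurable_indicator[OF Ac]]
      by (subst nn_integral_distr[OF cism]) auto
    also have "\<dots> = (\<integral>\<^sup>+t. g (s + t) * indicator {s..<s+2*pi} (s + t) \<partial>lborel)"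
      unfolding P_def
      by (subst nn_integral_restrict_space)
         (auto simp: g_def s cis_mult indicator_def intro!: nn_integral_cong)
    also have "\<dots> = (\<integral>\<^sup>+t. g t * indicator {s..<s+2*pi} t \<partial>lborel)"
      by (rule nn_integral_shift[where g = "\<lambda>t. g t * indicator {s..<s+2*pi} t"]) measurable
    also have "\<dots> = (\<integral>\<^sup>+t. g t * indicator {s..<2*pi} t + g t * indicator {2*pi..<s+2*pi} t \<partial>lborel)"
      using s by (intro nn_integral_cong) (auto simp: indicator_def)
    also have "\<dots> = (\<integral>\<^sup>+t. g t * indicator {s..<2*pi} t \<partial>lborel)
                 + (\<integral>\<^sup>+t. g t * indicator {2*pi..<s+2*pi} t \<partial>lborel)"
      by (rule nn_integral_add) measurable
    also have "(\<integral>\<^sup>+t. g t * indicator {2*pi..<s+2*pi} t \<partial>lborel)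
        = (\<integral>\<^sup>+t. g (2*pi + t) * indicator {2*pi..<s+2*pi} (2*pi + t) \<partial>lborel)"
      by (rule nn_integral_shift[where g = "\<lambda>t. g t * indicator {2*pi..<s+2*pi} t", symmetric])
         measurable
    also have "\<dots> = (\<integral>\<^sup>+t. g t * indicator {0..<s} t \<partial>lborel)"
      by (intro nn_integral_cong)
         (auto simp: g_def indicator_def cis_mult[symmetric])
    also have "(\<integral>\<^sup>+t. g t * indicator {s..<2*pi} t \<partial>lborel)
                 + (\<integral>\<^sup>+t. g t * indicator {0..<s} t \<partial>lborel)
        = (\<integral>\<^sup>+t. g t * indicator {s..<2*pi} t + g t * indicator {0..<s} t \<partial>lborel)"
      by (rule nn_integral_add[symmetric]) measurable
    also have "\<dots> = (\<integral>\<^sup>+t. g t * indicator {0..<2*pi} t \<partial>lborel)"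
      using s by (intro nn_integral_cong) (auto simp: indicator_def)
    also have "\<dots> = (\<integral>\<^sup>+t. indicator A (cis t) \<partial>P)"
      unfolding P_def by (subst nn_integral_restrict_space) (auto simp: g_def)
    also have "\<dots> = (\<integral>\<^sup>+x. indicator A x \<partial>arc)"
      unfolding arc_def using Ac by (subst nn_integral_distr[OF cism]) auto
    also have "\<dots> = emeasure arc A" using Ac by (simp add: arc_def)
    finally show "emeasure (distr arc circle_borel (\<lambda>t. u * t)) A = emeasure arc A" .
  qed
  moreover have "emeasure arc (space arc) = ennreal (2*pi)"
  proof -
    have "sphere 0 1 \<in> sets circle_borel"
      using sets.top[of circle_borel] by (simp add: space_restrict_space)
    then have "emeasure arc (space arc) = emeasure P (space P)"
      unfolding arc_def using cism
      by (subst emeasure_distr) (auto simp: space_restrict_space intro!: arg_cong[where f = "emeasure P"] dest: measurable_space)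
    also have "\<dots> = ennreal (2*pi)"
      by (simp add: P_def space_restrict_space emeasure_restrict_space)
    finally show ?thesis .
  qed
  ultimately show ?thesis
    by (simp add: circle_haar_def arc_def P_def)
qed

text \<open>The polar map is measurable, so that \<^const>\<open>nu\<close> is a genuine pushforward.\<close>

lemma measurable_polar:
  assumes "sets eta = sets unit_interval_borel" "sets lam = sets circle_borel"
  shows "(\<lambda>(r, t). complex_of_real r * t) \<in> eta \<Otimes>\<^sub>M lam \<rightarrow>\<^sub>M disk_borel"
proof -
  have [measurable]: "complex_of_real \<in> borel_measurable eta" "(\<lambda>t. t) \<in> borel_measurable lam"
    by (auto simp: measurable_cong_sets[OF assms(1) refl] measurable_cong_sets[OF assms(2) refl]
             intro: measurable_restrict_space1)
  have "space eta = {0..<1}" "space lam = sphere 0 1"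
    using assms[THEN sets_eq_imp_space_eq] by (auto simp: space_restrict_space)
  moreover have "(\<lambda>x. complex_of_real (fst x) * snd x) \<in> borel_measurable (eta \<Otimes>\<^sub>M lam)"
    by measurable
  ultimately show ?thesis
    by (intro measurable_restrict_space2)
       (auto simp: space_pair_measure norm_mult case_prod_beta')
qed

end

theory Submission
  imports Defs
begin

text \<open>
  With \<open>P = 1 / (1 - x)\<close> one has \<open>\<bar>1 - x\<bar>\<^sup>-\<^sup>2 (1 - \<bar>x\<bar>\<^sup>2) = P + cnj P - 1\<close>. Squaring expresses
  \<open>\<bar>1 - x\<bar>\<^sup>-\<^sup>4\<close> through \<open>P\<close>, \<open>P\<^sup>2\<close>, their conjugates and \<open>\<bar>1 - x\<bar>\<^sup>-\<^sup>2\<close>, with coefficients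
  depending only on \<open>\<bar>x\<bar>\<close>. Rotation invariance kills the nonconstant monomials, so the mean of
  \<open>P\<close> and of \<open>P\<^sup>2\<close> over a circle \<open>\<bar>x\<bar> = \<rho> < 1\<close> is \<open>1\<close>, and the circle mean of
  \<open>\<bar>1 - x\<bar>\<^sup>-\<^sup>4\<close> follows. Fubini's theorem then gives the Berezin transform.
\<close>

section \<open>Integrals over the circle from rotation invariance\<close>

locale circle_haar_measure =
  fixes lam :: "complex measure"
  assumes circle_haar: "circle_haar lam"
begin

lemma sets_lam [measurable_cong]: "sets lam = sets circle_borel"
  using circle_haar by (simp add: circle_haar_def)

lemma space_lam: "space lam = sphere 0 1"
  using sets_eq_imp_space_eq[OF sets_lam] by (simp add: space_restrict_space)

lemma emeasure_lam: "emeasure lam (space lam) = ennreal (2 * pi)"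
  using circle_haar by (simp add: circle_haar_def)

sublocale finite_measure lam
  by (rule finite_measureI) (simp add: emeasure_lam)

lemma measure_lam: "measure lam (space lam) = 2 * pi"
  by (simp add: measure_def emeasure_lam)

lemma borel_measurable_lam:
  "f \<in> borel_measurable borel \<Longrightarrow> f \<in> borel_measurable lam"
  by (simp add: measurable_cong_sets[OF sets_lam refl] measurable_restrict_space1)

lemma integral_rotate:
  fixes f :: "complex \<Rightarrow> 'a::{banach, second_countable_topology}"
  assumes u: "cmod u = 1" and f: "f \<in> borel_measurable borel"
  shows "(\<integral>t. f (u * t) \<partial>lam) = (\<integral>t. f t \<partial>lam)"
proof -
  have "distr lam circle_borel (\<lambda>t. u * t) = lam"
    using circle_haar u by (simp add: circle_haar_def)
  moreover have "(\<lambda>t. u * t) \<in> lam \<rightarrow>\<^sub>M circle_borel"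
    using measurable_rotation[OF u] by (simp add: measurable_cong_sets[OF sets_lam refl])
  ultimately show ?thesis
    by (metis integral_distr measurable_restrict_space1 f)
qed

lemma integrable_power: "integrable lam (\<lambda>t. t ^ k)"
  by (rule integrable_const_bound[where B = 1])
     (auto simp: space_lam norm_power intro!: AE_I2 borel_measurable_lam)

text \<open>Rotating by a \<open>k\<close>-th root of -1 leaves the integral unchanged but flips the
  sign of the integrand, so the integral equals its own negative.\<close>

lemma integral_power:
  assumes "k > 0"
  shows "(\<integral>t. t ^ k \<partial>lam) = 0"
proof -
  define u where "u = cis (pi / k)"
  have "u ^ k = -1"
    unfolding u_def by (subst Complex.DeMoivre) (use assms in simp)
  have "(\<integral>t. t ^ k \<partial>lam) = (\<integral>t. (u * t) ^ k \<partial>lam)"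
    by (rule integral_rotate[symmetric]) (auto simp: u_def)
  also have "\<dots> = - (\<integral>t. t ^ k \<partial>lam)"
    by (simp add: power_mult_distrib \<open>u ^ k = -1\<close>)
  finally show ?thesis
    by simp
qed

text \<open>On the circle the \<open>k\<close>-th term has constant modulus
  \<open>cmod (a k)\<close>, so the L1 norms of the terms are summable and the series may be
  integrated termwise; only the constant term survives. The expansion of \<open>f\<close> is
  required on the circle alone.\<close>

lemma integral_power_series:
  fixes a :: "nat \<Rightarrow> complex" and f :: "complex \<Rightarrow> complex"
  assumes a: "summable (\<lambda>k. cmod (a k))" and f: "\<And>t. cmod t = 1 \<Longrightarrow> (\<lambda>k. a k * t ^ k) sums f t"
  shows "integrable lam f" and "(\<integral>t. f t \<partial>lam) = 2 * pi * a 0"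
proof -
  have 1: "integrable lam (\<lambda>t. a k * t ^ k)" for k
    by (intro integrable_mult_right integrable_power)
  have 2: "AE t in lam. summable (\<lambda>k. norm (a k * t ^ k))"
    by (intro AE_I2) (use a in \<open>simp add: space_lam norm_mult norm_power\<close>)
  have "(\<integral>t. norm (a k * t ^ k) \<partial>lam) = (\<integral>t. cmod (a k) \<partial>lam)" for k
    by (intro Bochner_Integration.integral_cong) (auto simp: space_lam norm_mult norm_power)
  then have 3: "summable (\<lambda>k. \<integral>t. norm (a k * t ^ k) \<partial>lam)"
    using summable_mult[OF a, of "2 * pi"] by (simp add: measure_lam)
  have eq: "(\<Sum>k. a k * t ^ k) = f t" if "t \<in> space lam" for t
    using that f[of t] by (simp add: space_lam sums_iff)
  show "integrable lam f"
    using integrable_suminf[OF 1 2 3] eq by (simp cong: Bochner_Integration.integrable_cong)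
  have "(\<integral>t. f t \<partial>lam) = (\<Sum>k. \<integral>t. a k * t ^ k \<partial>lam)"
    using integral_suminf[OF 1 2 3] eq by (simp cong: Bochner_Integration.integral_cong)
  also have "\<dots> = (\<Sum>k\<in>{0}. \<integral>t. a k * t ^ k \<partial>lam)"
    by (rule suminf_finite) (auto simp: integral_power)
  also have "\<dots> = 2 * pi * a 0"
    by (simp add: measure_lam scaleR_conv_of_real)
  finally show "(\<integral>t. f t \<partial>lam) = 2 * pi * a 0" .
qed

lemma integral_geometric:
  assumes "cmod s < 1"
  shows "integrable lam (\<lambda>t. 1 / (1 - s * t))" and "(\<integral>t. 1 / (1 - s * t) \<partial>lam) = 2 * pi"
proof -
  have a: "summable (\<lambda>k. cmod (s ^ k))"
    using assms by (simp add: norm_power summable_geometric)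
  have f: "(\<lambda>k. s ^ k * t ^ k) sums (1 / (1 - s * t))" if "cmod t = 1" for t
    using geometric_sums[of "s * t"] assms that by (simp add: norm_mult power_mult_distrib)
  show "integrable lam (\<lambda>t. 1 / (1 - s * t))" "(\<integral>t. 1 / (1 - s * t) \<partial>lam) = 2 * pi"
    using integral_power_series[OF a f] by simp_all
qed

lemma integral_geometric_square:
  assumes "cmod s < 1"
  shows "integrable lam (\<lambda>t. 1 / (1 - s * t)\<^sup>2)" and "(\<integral>t. 1 / (1 - s * t)\<^sup>2 \<partial>lam) = 2 * pi"
proof -
  \<comment> \<open>The moduli \<open>(k + 1) * cmod s ^ k\<close> are the terms of the
    differentiated geometric series at the real point \<open>cmod s\<close>.\<close>
  have a: "summable (\<lambda>k. cmod (of_nat (Suc k) * s ^ k))"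
    using geometric_deriv_sums[of "cmod s"] assms
    by (simp add: norm_mult norm_power sums_iff del: of_nat_Suc)
  have f: "(\<lambda>k. of_nat (Suc k) * s ^ k * t ^ k) sums (1 / (1 - s * t)\<^sup>2)" if "cmod t = 1" for t
    using geometric_deriv_sums[of "s * t"] assms that
    by (simp add: norm_mult power_mult_distrib mult.assoc)
  show "integrable lam (\<lambda>t. 1 / (1 - s * t)\<^sup>2)" "(\<integral>t. 1 / (1 - s * t)\<^sup>2 \<partial>lam) = 2 * pi"
    using integral_power_series[OF a f] by simp_all
qed

lemma integral_Re_geometric:
  assumes "cmod s < 1"
  shows "integrable lam (\<lambda>t. Re (1 / (1 - s * t)))"
    and "(\<integral>t. Re (1 / (1 - s * t)) \<partial>lam) = 2 * pi"
    and "integrable lam (\<lambda>t. Re (1 / (1 - s * t)\<^sup>2))"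
    and "(\<integral>t. Re (1 / (1 - s * t)\<^sup>2) \<partial>lam) = 2 * pi"
  using integral_geometric[OF assms] integral_geometric_square[OF assms]
  by (simp_all only: integrable_Re integral_Re) simp_all

end

section \<open>Pointwise identities for inverse powers of |1 - x|\<close>

text \<open>Multiplied by \<open>1 - (cmod x)\<^sup>2\<close>, both sides are the Poisson
  kernel.\<close>

lemma inverse_cmod_power2_eq:
  assumes "cmod x < 1"
  shows "1 / (cmod (1 - x))\<^sup>2 = (2 * Re (1 / (1 - x)) - 1) / (1 - (cmod x)\<^sup>2)"
proof -
  have "x \<noteq> 1" using assms by auto
  have "Re (1 / (1 - x)) = (1 - Re x) / (cmod (1 - x))\<^sup>2"
    by (simp add: Re_divide cmod_power2)
  moreover have "2 * (1 - Re x) - (cmod (1 - x))\<^sup>2 = 1 - (cmod x)\<^sup>2"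
    unfolding cmod_power2 by (simp add: power2_eq_square algebra_simps)
  moreover have "1 - (cmod x)\<^sup>2 > 0"
    using assms by (simp add: power_less_one_iff abs_square_less_1)
  ultimately show ?thesis
    using \<open>x \<noteq> 1\<close> by (simp add: field_simps)
qed

text \<open>Square the Poisson kernel identity and remove the quadratic term by
  \<open>2 * (Re P)\<^sup>2 = Re (P\<^sup>2) + (cmod P)\<^sup>2\<close>. The numerator is then
  linear in functions whose circle means are accessible.\<close>

lemma inverse_cmod_power4_eq:
  assumes "cmod x < 1"
  shows "1 / cmod (1 - x) ^ 4 =
    (2 * Re (1 / (1 - x)\<^sup>2) + 2 / (cmod (1 - x))\<^sup>2 + 1 - 4 * Re (1 / (1 - x))) / (1 - (cmod x)\<^sup>2)\<^sup>2"
proof -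
  define P where "P = 1 / (1 - x)"
  have P: "Re P ^ 2 + Im P ^ 2 = 1 / (cmod (1 - x))\<^sup>2"
    by (simp add: P_def flip: cmod_power2) (simp add: norm_divide power_divide)
  have P2: "Re P ^ 2 - Im P ^ 2 = Re (1 / (1 - x)\<^sup>2)"
    unfolding power_one_over[symmetric] P_def[symmetric] by (simp add: power2_eq_square)
  have "1 / cmod (1 - x) ^ 4 = (1 / (cmod (1 - x))\<^sup>2)\<^sup>2"
    by (simp add: power_divide flip: power_mult)
  also have "\<dots> = (2 * Re P - 1)\<^sup>2 / (1 - (cmod x)\<^sup>2)\<^sup>2"
    by (simp add: inverse_cmod_power2_eq[OF assms] P_def power_divide)
  also have "(2 * Re P - 1)\<^sup>2 = 2 * (Re P ^ 2 - Im P ^ 2) + 2 * (Re P ^ 2 + Im P ^ 2) + 1 - 4 * Re P"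
    by (simp add: power2_eq_square algebra_simps)
  finally show ?thesis
    by (simp add: P P2) (simp add: P_def)
qed

section \<open>Circle means of the inverse powers\<close>

context circle_haar_measure
begin

text \<open>On the circle \<open>cmod (s * t) = cmod s\<close>, so the denominator of the Poisson
  kernel identity is constant in \<open>t\<close>, and the numerator integrates to
  \<open>2 * (2 * pi) - 2 * pi = 2 * pi\<close>.\<close>

lemma integral_cmod_power2:
  assumes s: "cmod s < 1"
  shows "integrable lam (\<lambda>t. 1 / (cmod (1 - s * t))\<^sup>2)"
    and "(\<integral>t. 1 / (cmod (1 - s * t))\<^sup>2 \<partial>lam) = 2 * pi / (1 - (cmod s)\<^sup>2)"
proof -
  have eq: "1 / (cmod (1 - s * t))\<^sup>2 = (2 * Re (1 / (1 - s * t)) - 1) / (1 - (cmod s)\<^sup>2)"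
    if "t \<in> space lam" for t
    using inverse_cmod_power2_eq[of "s * t"] s that by (simp add: space_lam norm_mult)
  note I = integral_Re_geometric[OF s]
  show "integrable lam (\<lambda>t. 1 / (cmod (1 - s * t))\<^sup>2)"
    by (subst Bochner_Integration.integrable_cong[OF refl eq]) (use I in auto)
  have "(\<integral>t. 1 / (cmod (1 - s * t))\<^sup>2 \<partial>lam)
      = (\<integral>t. (2 * Re (1 / (1 - s * t)) - 1) / (1 - (cmod s)\<^sup>2) \<partial>lam)"
    by (intro Bochner_Integration.integral_cong eq refl)
  also have "\<dots> = 2 * pi / (1 - (cmod s)\<^sup>2)"
    using I(1) by (simp add: I(2) measure_lam del: Re_divide_of_real)
  finally show "(\<integral>t. 1 / (cmod (1 - s * t))\<^sup>2 \<partial>lam) = 2 * pi / (1 - (cmod s)\<^sup>2)" .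
qed

lemma integral_cmod_power4:
  assumes s: "cmod s < 1"
  shows "(\<integral>t. 1 / cmod (1 - s * t) ^ 4 \<partial>lam) = 2 * pi * ((1 + (cmod s)\<^sup>2) / (1 - (cmod s)\<^sup>2) ^ 3)"
proof -
  define c where "c = 1 - (cmod s)\<^sup>2"
  have c: "c \<noteq> 0" "(cmod s)\<^sup>2 = 1 - c"
    using s power_less_one_iff[of "cmod s" 2] by (auto simp: c_def)
  note I = integral_Re_geometric[OF s] integral_cmod_power2[OF s, folded c_def]
  have lin: "(\<integral>t. (2 * f t + 2 * g t + 1 - 4 * h t) / d \<partial>lam)
      = (2 * (\<integral>t. f t \<partial>lam) + 2 * (\<integral>t. g t \<partial>lam) + 2 * pi - 4 * (\<integral>t. h t \<partial>lam)) / d"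
    if "integrable lam f" "integrable lam g" "integrable lam h" for f g h :: "complex \<Rightarrow> real" and d
    using that by (simp add: measure_lam)
  have "(\<integral>t. 1 / cmod (1 - s * t) ^ 4 \<partial>lam)
      = (\<integral>t. (2 * Re (1 / (1 - s * t)\<^sup>2) + 2 * (1 / (cmod (1 - s * t))\<^sup>2) + 1
            - 4 * Re (1 / (1 - s * t))) / c\<^sup>2 \<partial>lam)"
    using inverse_cmod_power4_eq[of "s * _"] s
    by (intro Bochner_Integration.integral_cong) (auto simp: space_lam norm_mult c_def)
  also have "\<dots> = (2 * (2 * pi) + 2 * (2 * pi / c) + 2 * pi - 4 * (2 * pi)) / c\<^sup>2"
    by (simp only: lin[OF I(3,5,1)] I(2,4,6))
  \<comment> \<open>Dividing the numerator by \<open>2 * pi\<close> leaves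
    \<open>2 + 2 / c + 1 - 4 = (2 - c) / c\<close>, and
    \<open>2 - c = 1 + (cmod s)\<^sup>2\<close>.\<close>
  also have "\<dots> = 2 * pi * ((1 + (cmod s)\<^sup>2) / c ^ 3)"
    unfolding c(2) using c(1) by (simp add: field_simps power2_eq_square power3_eq_cube)
  finally show ?thesis
    by (simp add: c_def)
qed

end

section \<open>Fubini in polar coordinates\<close>

theorem proposition4p3:
  fixes eta :: "real measure" and lam :: "complex measure"
  assumes "finite_measure eta" and "sets eta = sets unit_interval_borel"
    and "circle_haar lam"
  shows "\<forall>w \<in> ball 0 1. Ber (nu lam eta) w = beta eta (cmod w)"
proof
  fix z :: complex
  assume "z \<in> ball 0 1"
  then have z: "cmod z < 1" by simp
  interpret lam: circle_haar_measure lam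
    using assms(3) by unfold_locales
  interpret eta: finite_measure eta by fact
  interpret pair_sigma_finite eta lam ..
  have space_eta: "space eta = {0..<1}"
    using sets_eq_imp_space_eq[OF assms(2)] by (simp add: space_restrict_space)
  define g where "g = (\<lambda>w. 1 / cmod (1 - cnj z * w) ^ 4)"
  have g [measurable]: "g \<in> borel_measurable borel"
    unfolding g_def by measurable
  have polar: "(\<lambda>(r, t). complex_of_real r * t) \<in> eta \<Otimes>\<^sub>M lam \<rightarrow>\<^sub>M disk_borel"
    using measurable_polar[OF assms(2) lam.sets_lam] .
  \<comment> \<open>For fixed \<open>z\<close> the kernel is bounded on the whole disk, since |1 -
    cnj z w| >= 1 - |z|. As the product measure is finite, this gives the integrability that
    Fubini's theorem asks for.\<close>
  have g_bound: "g w \<le> 1 / (1 - cmod z) ^ 4" if "cmod w < 1" for w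
  proof -
    have "cmod (cnj z * w) \<le> cmod z"
      using that by (simp add: norm_mult mult_left_le)
    then have "1 - cmod z \<le> cmod (1 - cnj z * w)"
      using norm_triangle_ineq2[of 1 "cnj z * w"] by simp
    then show ?thesis
      unfolding g_def using z by (intro divide_left_mono power_mono mult_pos_pos zero_less_power) auto
  qed
  interpret pair: finite_measure "eta \<Otimes>\<^sub>M lam"
    by (intro finite_measure_pair_measure) unfold_locales
  have int: "integrable (eta \<Otimes>\<^sub>M lam) (\<lambda>(r, t). g (complex_of_real r * t))"
  proof (rule pair.integrable_const_bound)
    show "AE x in eta \<Otimes>\<^sub>M lam. norm (case x of (r, t) \<Rightarrow> g (complex_of_real r * t)) \<le> 1 / (1 - cmod z) ^ 4"
      using g_bound
      by (intro AE_I2) (auto simp: space_pair_measure space_eta lam.space_lam norm_mult g_def)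
    show "(\<lambda>(r, t). g (complex_of_real r * t)) \<in> borel_measurable (eta \<Otimes>\<^sub>M lam)"
      using measurable_compose[OF polar measurable_restrict_space1[OF g]]
      by (simp add: case_prod_beta')
  qed
  have "(\<integral>w. g w \<partial>nu lam eta) = (\<integral>(r, t). g (complex_of_real r * t) \<partial>(eta \<Otimes>\<^sub>M lam))"
    unfolding nu_def
    by (subst integral_distr[OF polar measurable_restrict_space1[OF g]]) (simp add: case_prod_beta')
  also have "\<dots> = (\<integral>r. \<integral>t. g (complex_of_real r * t) \<partial>lam \<partial>eta)"
    by (rule integral_fst'[OF int, symmetric, simplified])
  also have "\<dots> = (\<integral>r. 2 * pi * ((1 + (cmod z)\<^sup>2 * r\<^sup>2) / (1 - (cmod z)\<^sup>2 * r\<^sup>2) ^ 3) \<partial>eta)"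
  proof (rule Bochner_Integration.integral_cong[OF refl])
    fix r
    assume "r \<in> space eta"
    then have r: "0 \<le> r" "r < 1"
      by (auto simp: space_eta)
    \<comment> \<open>The circle mean is taken with \<open>s = cnj z * r\<close>, for which
      \<open>(cmod s)\<^sup>2 = (cmod z)\<^sup>2 * r\<^sup>2\<close>.\<close>
    then have "cmod (cnj z * r) < 1"
      using z mult_strict_mono'[of "cmod z" 1 r 1] by (simp add: norm_mult)
    from lam.integral_cmod_power4[OF this]
    show "(\<integral>t. g (complex_of_real r * t) \<partial>lam)
        = 2 * pi * ((1 + (cmod z)\<^sup>2 * r\<^sup>2) / (1 - (cmod z)\<^sup>2 * r\<^sup>2) ^ 3)"
      using r by (simp add: g_def norm_mult power_mult_distrib mult.assoc)
  qed
  also have "\<dots> = 2 * pi * (\<integral>r. (1 + (cmod z)\<^sup>2 * r\<^sup>2) / (1 - (cmod z)\<^sup>2 * r\<^sup>2) ^ 3 \<partial>eta)"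
    by (rule integral_mult_right_zero)
  \<comment> \<open>The total mass \<open>2 * pi\<close> against the factor \<open>1 / pi\<close> in
    \<open>Ber\<close> leaves the leading 2 of \<open>beta\<close>.\<close>
  finally show "Ber (nu lam eta) z = beta eta (cmod z)"
    by (simp add: Ber_def beta_def g_def)
qed

end
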